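(* Let $S, A$ be nonempty finite sets. The set $T = S \triangleright A$ of all policies has the value-laden Bellman property for teleo-optimality; that is: for every policy $\pi \in T$ that is $T$-optimal for a teleo-environment $\varepsilon \in A \triangleright (S \times G)$, every $n \in \mathbb{N}$ and every trajectory $(\mathbf{a}, \mathbf{s}) \in A^n \times S^n$, if $\varepsilon' = \varepsilon \bullet (\mathbf{a} : (\mathbf{s} : \bot^n))$ and $\pi' = \pi \bullet (\mathbf{s} : \mathbf{a})$ are valid, then $\pi'$ is $T'$-optimal for $\varepsilon'$, where $T' = T \bullet (\mathbf{s} : \mathbf{a})$.
   Context: For a finite set $X$, $P(X)$ is the set of probability distributions on $X$ and $\mathrm{supp}(p)$ is the support of $p\in P(X)$. For finite sets $I$ (inputs) and $O$ (outputs), the set $I \triangleright O$ of transducers is defined coinductively (it is the final coalgebra of $X \mapsto \sum_{p \in P(O)} (I \times \mathrm{supp}(p) \to X)$): a transducer $\pi$ is a pair $(\mathbb{P}_\pi, \mathbb{T}_\pi)$ with $\mathbb{P}_\pi \in P(O)$ and $\mathbb{T}_\pi : I \times \mathrm{supp}(\mathbb{P}_\pi) \to I \triangleright O$. Evolution: for strings $\mathbf{i}\in I^n$, $\mathbf{o}\in O^n$, $(\mathbf{i}:\mathbf{o})$ denotes the string of pairs $(\mathbf i_k,\mathbf o_k)$. Evolution by the empty string is $\pi$, and $\pi \bullet (\mathbf{i}\cdot i : \mathbf{o} \cdot o) = \mathbb{T}_{\pi \bullet (\mathbf{i}:\mathbf{o})}(i,o)$ if $\pi\bullet(\mathbf{i}:\mathbf{o})$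 is defined and $o \in \mathrm{supp}(\mathbb{P}_{\pi\bullet(\mathbf{i}:\mathbf{o})})$; otherwise it is undefined. An evolution is valid if it is defined. For $T \subseteq I \triangleright O$, $T\bullet(\mathbf{i}:\mathbf{o}) = \{\pi'\bullet(\mathbf{i}:\mathbf{o}) : \pi' \in T,\ \text{the evolution is valid}\}$. Let $G = \{\bot,\top\}$ ($\top$ = success). A policy is an element of $S\triangleright A$; a teleo-environment is an element of $A \triangleright (S\times G)$; $\bot^n$ is the string of $n$ copies of $\bot$. The success probability $\mathcal{S}(\pi,\varepsilon)$ is $\lim_{n\to\infty} \mathcal{S}_n(\pi,\varepsilon)$, where $\mathcal{S}_0(\pi,\varepsilon) = \sum_{s\in S} \mathbb{P}_\varepsilon(s,\top)$ and $\mathcal{S}_{n+1}(\pi,\varepsilon) = \sum_{s\in S}\sum_{a\in A} \left[\mathbb{P}_\pi(a)\mathbb{P}_\varepsilon(s,\top) + \mathbb{P}_\pi(a)\mathbb{P}_\varepsilon(s,\bot)\, \mathcal{S}_n\big(\mathbb{T}_\pi(s,a), \mathbb{T}_\varepsilon(a,(s,\bot))\big)\right]$ (terms with zero coefficient are omitted). For $T\subseteq S\triangleright A$, a policy $\pi\in T$ is $T$-optimal for $\varepsilon$ if $\mathcal{S}(\pi',\varepsilon)\le \mathcal{S}(\pi,\varepsilon)$ for all $\pi'\in T$. *)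

theory Defs
  imports "HOL-Probability.Probability"
begin

(* The transition map of a node is partial; the set transducers below cuts out the
   trees in which it is defined exactly on I x supp(p) at every node, so that
   transducers is (the carrier of) the final coalgebra of
   X |-> SUM p : P(O). (I x supp(p) -> X). The finite sets I and O are rendered as types. *)
codatatype ('i, 'o) transducer =
  Transducer (out_pmf: "'o pmf") (step: "'i \<times> 'o \<Rightarrow> ('i, 'o) transducer option")

coinductive_set transducers :: "('i, 'o) transducer set" where
  "\<lbrakk>dom t = UNIV \<times> set_pmf p; \<And>x \<rho>. t x = Some \<rho> \<Longrightarrow> \<rho> \<in> transducers\<rbrakk>
    \<Longrightarrow> Transducer p t \<in> transducers"

(* A string (i : o) of pairs is the list zip i o; None means that the evolution is undefined.
   On transducers, step \<rho> (i, o) is None exactly if o lies outside the support of out_pmf \<rho>. *)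
definition evolve :: "('i, 'o) transducer \<Rightarrow> ('i \<times> 'o) list \<Rightarrow> ('i, 'o) transducer option" where
  "evolve \<pi> xs = foldl (\<lambda>r x. Option.bind r (\<lambda>\<rho>. step \<rho> x)) (Some \<pi>) xs"

lemma evolve_Nil: "evolve \<pi> [] = Some \<pi>"
  by (simp add: evolve_def)

lemma evolve_snoc: "evolve \<pi> (xs @ [x]) = Option.bind (evolve \<pi> xs) (\<lambda>\<rho>. step \<rho> x)"
  by (simp add: evolve_def)

lemma step_eq_None_iff:
  assumes "\<rho> \<in> transducers"
  shows "step \<rho> (i, b) = None \<longleftrightarrow> b \<notin> set_pmf (out_pmf \<rho>)"
  using assms
proof cases
  case (1 t p)
  then have "(i, b) \<in> dom t \<longleftrightarrow> b \<in> set_pmf p" by simp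
  then show ?thesis using 1(1) by (auto simp: domIff)
qed

lemma evolve_in_transducers:
  assumes "\<pi> \<in> transducers" "evolve \<pi> xs = Some \<rho>"
  shows "\<rho> \<in> transducers"
  using assms(2)
proof (induction xs arbitrary: \<rho> rule: rev_induct)
  case Nil
  then show ?case using assms(1) by (simp add: evolve_Nil)
next
  case (snoc x xs)
  then obtain \<sigma> where s: "evolve \<pi> xs = Some \<sigma>" "step \<sigma> x = Some \<rho>"
    by (auto simp: evolve_snoc bind_eq_Some_conv)
  from snoc.IH[OF s(1)] s(2) show ?case by cases auto
qed

definition evolve_set ::
  "('i, 'o) transducer set \<Rightarrow> ('i \<times> 'o) list \<Rightarrow> ('i, 'o) transducer set" where
  "evolve_set T xs = {\<rho>. \<exists>\<pi>\<in>T. evolve \<pi> xs = Some \<rho>}"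

(* Signals G are booleans, with True for success. *)
type_synonym ('s, 'a) policy = "('s, 'a) transducer"
type_synonym ('s, 'a) teleo_env = "('a, 's \<times> bool) transducer"

(* Where a transition is undefined, the value of "the" is multiplied by a zero coefficient. *)
primrec success_n ::
  "nat \<Rightarrow> ('s::finite, 'a::finite) policy \<Rightarrow> ('s, 'a) teleo_env \<Rightarrow> real" where
  "success_n 0 \<pi> \<epsilon> = (\<Sum>s\<in>UNIV. pmf (out_pmf \<epsilon>) (s, True))"
| "success_n (Suc n) \<pi> \<epsilon> = (\<Sum>s\<in>UNIV. \<Sum>a\<in>UNIV.
     pmf (out_pmf \<pi>) a * pmf (out_pmf \<epsilon>) (s, True)
     + pmf (out_pmf \<pi>) a * pmf (out_pmf \<epsilon>) (s, False)
       * success_n n (the (step \<pi> (s, a))) (the (step \<epsilon> (a, (s, False)))))"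

definition success :: "('s::finite, 'a::finite) policy \<Rightarrow> ('s, 'a) teleo_env \<Rightarrow> real" where
  "success \<pi> \<epsilon> = lim (\<lambda>n. success_n n \<pi> \<epsilon>)"

lemma sum_pmf_UNIV: "(\<Sum>x\<in>UNIV. pmf p x) = 1" for p :: "'b::finite pmf"
  by (rule sum_pmf_eq_1) auto

lemma sum_pmf_pair_bool:
  "(\<Sum>s\<in>UNIV. pmf p (s, True)) + (\<Sum>s\<in>UNIV. pmf p (s, False)) = 1"
  for p :: "('s::finite \<times> bool) pmf"
proof -
  have "(\<Sum>x\<in>UNIV. pmf p x) = (\<Sum>s\<in>UNIV. \<Sum>b\<in>UNIV. pmf p (s, b))"
    by (simp add: sum.cartesian_product flip: UNIV_Times_UNIV)
  also have "\<dots> = (\<Sum>s\<in>UNIV. pmf p (s, True)) + (\<Sum>s\<in>UNIV. pmf p (s, False))"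
    by (simp add: UNIV_bool sum.distrib add.commute)
  finally show ?thesis by (simp add: sum_pmf_UNIV)
qed

lemma success_n_nonneg: "0 \<le> success_n n \<pi> \<epsilon>"
  by (induction n arbitrary: \<pi> \<epsilon>) (auto intro!: sum_nonneg add_nonneg_nonneg mult_nonneg_nonneg)

lemma sum_pmf_mult_swap:
  "(\<Sum>s\<in>UNIV. \<Sum>a\<in>UNIV. pmf q a * f s) = (\<Sum>s\<in>UNIV. f s)"
  for q :: "'a::finite pmf" and f :: "'s::finite \<Rightarrow> real"
  by (simp add: sum_pmf_UNIV flip: sum_distrib_right)

lemma success_n_le_1: "success_n n \<pi> \<epsilon> \<le> 1"
proof (induction n arbitrary: \<pi> \<epsilon>)
  case 0
  have "0 \<le> (\<Sum>s\<in>UNIV. pmf (out_pmf \<epsilon>) (s, False))"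
    by (simp add: sum_nonneg)
  then show ?case using sum_pmf_pair_bool[of "out_pmf \<epsilon>"] by simp
next
  case (Suc n)
  have "success_n (Suc n) \<pi> \<epsilon> \<le> (\<Sum>s\<in>UNIV. \<Sum>a\<in>UNIV.
      pmf (out_pmf \<pi>) a * (pmf (out_pmf \<epsilon>) (s, True) + pmf (out_pmf \<epsilon>) (s, False)))"
    unfolding success_n.simps distrib_left
    by (intro sum_mono add_left_mono mult_left_le Suc.IH mult_nonneg_nonneg pmf_nonneg)
  also have "\<dots> = 1"
    by (simp only: sum_pmf_mult_swap sum.distrib sum_pmf_pair_bool)
  finally show ?case .
qed

lemma success_n_le_Suc: "success_n n \<pi> \<epsilon> \<le> success_n (Suc n) \<pi> \<epsilon>"
proof (induction n arbitrary: \<pi> \<epsilon>)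
  case 0
  have "success_n 0 \<pi> \<epsilon>
      = (\<Sum>s\<in>UNIV. \<Sum>a\<in>UNIV. pmf (out_pmf \<pi>) a * pmf (out_pmf \<epsilon>) (s, True))"
    by (simp add: sum_pmf_mult_swap)
  also have "\<dots> \<le> success_n (Suc 0) \<pi> \<epsilon>"
    unfolding success_n.simps(2)
    by (intro sum_mono) (simp add: success_n_nonneg del: success_n.simps)
  finally show ?case .
next
  case (Suc n)
  show ?case
    unfolding success_n.simps(2)[of "Suc n"] success_n.simps(2)[of n \<pi> \<epsilon>]
    by (intro sum_mono add_left_mono mult_left_mono Suc.IH mult_nonneg_nonneg pmf_nonneg)
qed

lemma success_n_tendsto_success: "(\<lambda>n. success_n n \<pi> \<epsilon>) \<longlonglongrightarrow> success \<pi> \<epsilon>"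
proof -
  have "incseq (\<lambda>n. success_n n \<pi> \<epsilon>)"
    by (rule incseq_SucI) (rule success_n_le_Suc)
  then have "convergent (\<lambda>n. success_n n \<pi> \<epsilon>)"
    using incseq_convergent[of "\<lambda>n. success_n n \<pi> \<epsilon>" 1] success_n_le_1
    by (metis convergentI)
  then show ?thesis unfolding success_def by (simp add: convergent_LIMSEQ_iff)
qed

definition teleo_optimal ::
  "('s::finite, 'a::finite) policy set \<Rightarrow> ('s, 'a) teleo_env \<Rightarrow> ('s, 'a) policy \<Rightarrow> bool" where
  "teleo_optimal T \<epsilon> \<pi> \<longleftrightarrow> \<pi> \<in> T \<and> (\<forall>\<pi>'\<in>T. success \<pi>' \<epsilon> \<le> success \<pi> \<epsilon>)"

(* In the evolution of the environment, all signals along the trajectory are failures. *)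
definition value_laden_bellman_teleo :: "('s::finite, 'a::finite) policy set \<Rightarrow> bool" where
  "value_laden_bellman_teleo T \<longleftrightarrow>
    (\<forall>\<pi>. \<forall>\<epsilon>\<in>transducers. teleo_optimal T \<epsilon> \<pi> \<longrightarrow>
      (\<forall>n as ss \<epsilon>' \<pi>'. length as = n \<longrightarrow> length ss = n \<longrightarrow>
        evolve \<epsilon> (zip as (zip ss (replicate n False))) = Some \<epsilon>' \<longrightarrow>
        evolve \<pi> (zip ss as) = Some \<pi>' \<longrightarrow>
        teleo_optimal (evolve_set T (zip ss as)) \<epsilon>' \<pi>'))"

end

theory Submission
  imports Defs
begin

text \<open>Grafting an arbitrary policy onto the branch \<open>(s, a)\<close> of an optimal policy changes its success
  probability by the gain at that branch times the probability of reaching it. On a valid trajectory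
  that probability is positive, so the gain cannot be positive. Hence optimality is inherited by
  one step, and by induction by every valid evolution.\<close>

text \<open>Both sides are limits of the shifted sequence \<open>success_n (Suc n)\<close>: its
  recursion is a finite sum, so the limit passes through it termwise.\<close>

lemma success_eq:
  "success \<pi> \<epsilon> = (\<Sum>s\<in>UNIV. \<Sum>a\<in>UNIV.
     pmf (out_pmf \<pi>) a * pmf (out_pmf \<epsilon>) (s, True)
     + pmf (out_pmf \<pi>) a * pmf (out_pmf \<epsilon>) (s, False)
       * success (the (step \<pi> (s, a))) (the (step \<epsilon> (a, (s, False)))))"
proof (rule LIMSEQ_unique)
  show "(\<lambda>n. success_n (Suc n) \<pi> \<epsilon>) \<longlonglongrightarrow> success \<pi> \<epsilon>"
    by (rule LIMSEQ_Suc) (rule success_n_tendsto_success)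
  show "(\<lambda>n. success_n (Suc n) \<pi> \<epsilon>) \<longlonglongrightarrow> (\<Sum>s\<in>UNIV. \<Sum>a\<in>UNIV.
     pmf (out_pmf \<pi>) a * pmf (out_pmf \<epsilon>) (s, True)
     + pmf (out_pmf \<pi>) a * pmf (out_pmf \<epsilon>) (s, False)
       * success (the (step \<pi> (s, a))) (the (step \<epsilon> (a, (s, False)))))"
    unfolding success_n.simps by (intro tendsto_intros success_n_tendsto_success)
qed

definition graft :: "('i, 'o) transducer \<Rightarrow> 'i \<times> 'o \<Rightarrow> ('i, 'o) transducer \<Rightarrow> ('i, 'o) transducer" where
  "graft \<pi> x \<sigma> = Transducer (out_pmf \<pi>) ((step \<pi>)(x \<mapsto> \<sigma>))"

lemma graft_in_transducers:
  assumes "\<pi> \<in> transducers" "\<sigma> \<in> transducers" "step \<pi> x \<noteq> None"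
  shows "graft \<pi> x \<sigma> \<in> transducers"
  using assms(1)
proof cases
  case (1 t p)
  show ?thesis
    unfolding graft_def
  proof (rule transducers.intros)
    show "dom ((step \<pi>)(x \<mapsto> \<sigma>)) = UNIV \<times> set_pmf (out_pmf \<pi>)"
      using 1 assms(3) by auto
  qed (use 1 assms(2) in \<open>auto split: if_splits\<close>)
qed

text \<open>The two policies share the root distribution and every other branch, so their expansions
  by \<open>success_eq\<close> differ in a single summand.\<close>

lemma success_graft:
  fixes \<pi> :: "('s::finite, 'a::finite) policy"
  shows "success (graft \<pi> (s, a) \<sigma>) \<epsilon> - success \<pi> \<epsilon> =
    pmf (out_pmf \<pi>) a * pmf (out_pmf \<epsilon>) (s, False)
    * (success \<sigma> (the (step \<epsilon> (a, (s, False))))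
       - success (the (step \<pi> (s, a))) (the (step \<epsilon> (a, (s, False)))))"
    (is "_ = ?d")
proof -
  have "success (graft \<pi> (s, a) \<sigma>) \<epsilon> - success \<pi> \<epsilon>
      = (\<Sum>s'\<in>UNIV. \<Sum>a'\<in>UNIV. if s' = s \<and> a' = a then ?d else 0)"
    unfolding success_eq[of "graft \<pi> (s, a) \<sigma>" \<epsilon>] success_eq[of \<pi> \<epsilon>] sum_subtractf[symmetric]
    by (intro sum.cong refl) (auto simp: graft_def right_diff_distrib)
  \<comment> \<open>Splitting the conjunction into nested conditionals lets each sum collapse on its
    own.\<close>
  also have "\<dots> = (\<Sum>s'\<in>UNIV. if s' = s then \<Sum>a'\<in>UNIV. if a' = a then ?d else 0 else 0)"
    by (intro sum.cong) auto
  also have "\<dots> = ?d"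
    by simp
  finally show ?thesis .
qed

lemma step_Some_imp_in_set_pmf:
  assumes "\<rho> \<in> transducers" "step \<rho> (i, b) = Some \<sigma>"
  shows "b \<in> set_pmf (out_pmf \<rho>)"
  using step_eq_None_iff[OF assms(1), of i b] assms(2) by auto

text \<open>The left fold gives \<open>evolve_snoc\<close>, which peels off the last pair; the
  induction along a trajectory advances the starting point and so has to peel off the first.\<close>

lemma evolve_Cons: "evolve \<pi> (x # xs) = Option.bind (step \<pi> x) (\<lambda>\<rho>. evolve \<rho> xs)"
proof (induction xs rule: rev_induct)
  case Nil
  then show ?case by (simp add: evolve_def)
next
  case (snoc y ys)
  have "evolve \<pi> (x # ys @ [y]) = Option.bind (evolve \<pi> (x # ys)) (\<lambda>\<rho>. step \<rho> y)"
    using evolve_snoc[of \<pi> "x # ys"] by simp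
  then show ?case by (simp add: snoc.IH evolve_snoc)
qed

lemma step_in_transducers:
  assumes "\<rho> \<in> transducers" "step \<rho> x = Some \<sigma>"
  shows "\<sigma> \<in> transducers"
  using assms evolve_in_transducers[of \<rho> "[x]" \<sigma>] by (simp add: evolve_def)

lemma teleo_optimal_step:
  fixes \<pi> \<pi>' :: "('s::finite, 'a::finite) policy"
  assumes opt: "teleo_optimal transducers \<epsilon> \<pi>"
    and \<epsilon>: "\<epsilon> \<in> transducers" "step \<epsilon> (a, (s, False)) = Some \<epsilon>'"
    and \<pi>': "step \<pi> (s, a) = Some \<pi>'"
  shows "teleo_optimal transducers \<epsilon>' \<pi>'"
  unfolding teleo_optimal_def
proof (intro conjI ballI)
  have \<pi>: "\<pi> \<in> transducers"
    using opt by (simp add: teleo_optimal_def)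
  then show "\<pi>' \<in> transducers"
    using \<pi>' by (rule step_in_transducers)
  fix \<sigma> :: "('s, 'a) policy"
  assume "\<sigma> \<in> transducers"
  \<comment> \<open>The graft is again a policy, hence a competitor of \<open>\<pi>\<close>; this is
    where \<open>T\<close> being the set of all policies matters.\<close>
  then have "success (graft \<pi> (s, a) \<sigma>) \<epsilon> \<le> success \<pi> \<epsilon>"
    using opt \<pi>' graft_in_transducers[OF \<pi>] by (simp add: teleo_optimal_def)
  then have "pmf (out_pmf \<pi>) a * pmf (out_pmf \<epsilon>) (s, False) * (success \<sigma> \<epsilon>' - success \<pi>' \<epsilon>') \<le> 0"
    using success_graft[of \<pi> s a \<sigma> \<epsilon>] \<epsilon>(2) \<pi>' by simp
  \<comment> \<open>Both transitions are defined, which puts \<open>a\<close> and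
    \<open>(s, False)\<close> in the respective supports.\<close>
  moreover have "0 < pmf (out_pmf \<pi>) a * pmf (out_pmf \<epsilon>) (s, False)"
    using step_Some_imp_in_set_pmf[OF \<pi> \<pi>'] step_Some_imp_in_set_pmf[OF \<epsilon>]
    by (simp add: pmf_positive)
  ultimately show "success \<sigma> \<epsilon>' \<le> success \<pi>' \<epsilon>'"
    by (auto simp: mult_le_0_iff)
qed

text \<open>Optimality is kept against all policies, not only evolved ones, so that
  \<open>teleo_optimal_step\<close> applies again at each pair.\<close>

lemma teleo_optimal_evolve:
  assumes "length as = length ss"
    and "teleo_optimal transducers \<epsilon> \<pi>" "\<epsilon> \<in> transducers"
    and "evolve \<epsilon> (zip as (zip ss (replicate (length ss) False))) = Some \<epsilon>'"
    and "evolve \<pi> (zip ss as) = Some \<pi>'"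
  shows "teleo_optimal transducers \<epsilon>' \<pi>'"
  using assms
proof (induction as ss arbitrary: \<epsilon> \<pi> rule: list_induct2)
  case Nil
  then show ?case by (simp add: evolve_Nil)
next
  case (Cons a as s ss)
  then obtain \<epsilon>\<^sub>1 \<pi>\<^sub>1 where 1: "step \<epsilon> (a, (s, False)) = Some \<epsilon>\<^sub>1" "step \<pi> (s, a) = Some \<pi>\<^sub>1"
    and "evolve \<epsilon>\<^sub>1 (zip as (zip ss (replicate (length ss) False))) = Some \<epsilon>'"
    and "evolve \<pi>\<^sub>1 (zip ss as) = Some \<pi>'"
    by (auto simp: evolve_Cons bind_eq_Some_conv)
  moreover have "teleo_optimal transducers \<epsilon>\<^sub>1 \<pi>\<^sub>1"
    using Cons.prems(1,2) 1 by (rule teleo_optimal_step)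
  moreover have "\<epsilon>\<^sub>1 \<in> transducers"
    using Cons.prems(2) 1(1) by (rule step_in_transducers)
  ultimately show ?case
    by (intro Cons.IH)
qed

theorem corollary5p0p3:
  "value_laden_bellman_teleo (transducers :: ('s::finite, 'a::finite) policy set)"
  unfolding value_laden_bellman_teleo_def
proof (intro allI ballI impI)
  fix \<pi> \<pi>' :: "('s, 'a) policy" and \<epsilon> \<epsilon>' :: "('s, 'a) teleo_env" and n as ss
  assume opt: "teleo_optimal transducers \<epsilon> \<pi>" and \<epsilon>: "\<epsilon> \<in> transducers"
    and len: "length as = n" "length ss = n"
    and ev: "evolve \<epsilon> (zip as (zip ss (replicate n False))) = Some \<epsilon>'"
    and ev': "evolve \<pi> (zip ss as) = Some \<pi>'"
  have "teleo_optimal transducers \<epsilon>' \<pi>'"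
    using teleo_optimal_evolve[OF _ opt \<epsilon> _ ev'] len ev by simp
  moreover have "\<pi>' \<in> evolve_set transducers (zip ss as)"
    using opt ev' by (auto simp: evolve_set_def teleo_optimal_def)
  \<comment> \<open>Optimality among all policies passes to any subset containing
    \<open>\<pi>'\<close>.\<close>
  moreover have "evolve_set transducers (zip ss as) \<subseteq> transducers"
    by (auto simp: evolve_set_def intro: evolve_in_transducers)
  ultimately show "teleo_optimal (evolve_set transducers (zip ss as)) \<epsilon>' \<pi>'"
    unfolding teleo_optimal_def by blast
qed

end
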